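(* Let $(X_1,\dots,X_n)$ be a random vector of nonnegative component lifetimes with an absolutely continuous joint distribution and with identically distributed (possibly dependent) components, having common reliability function $\bar F(x)=\Pr(X_i>x)$, $i=1,\dots,n$. Let $T_1=\phi_1(X_1,\dots,X_n)$ and $T=\phi(X_1,\dots,X_n)$ be the lifetimes of two coherent systems based on these same components. Assume that $T_1<T$ with probability one and that $(T_1,T)$ has an absolutely continuous joint distribution. Then there exists a bivariate distortion function $\widehat D:[0,1]^2\to[0,1]$ such that the joint reliability function $\bar G(x,y):=\Pr(T_1>x,\,T>y)$ satisfies $$\bar G(x,y)=\widehat D(\bar F(x),\bar F(y))\quad\text{for all } x,y.$$ Moreover, the reliability function of the conditional random variable $(T\mid T_1=t)$ is $$\bar G_{T|T_1}(y|t):=\Pr(T>y\mid T_1=t)=\frac{\partial_1\widehat D(\bar F(t),\bar F(y))-\partial_1\widehat D(\bar F(t),0^+)}{\partial_1\widehat D(\bar F(t),1)}\quad\text{for } y\ge t,$$ where $\partial_1\widehat D(u,0^+):=\lim_{v\to0^+}\partial_1\widehat D(u,v)$.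
   Context: Coherent systems: a structure function is a map $\phi:\{0,1\}^n\to\{0,1\}$, where $x_i=1$ means that component $i$ works, $x_i=0$ that it has failed, and $\phi(x_1,\dots,x_n)$ is the state of the system. The system is coherent if $\phi$ is increasing (i.e. non-decreasing) in each variable and every component is relevant (for each component $i$ there is a configuration of states of the other components for which the state of the system coincides with the state of component $i$). Path sets: a set $P\subseteq\{1,\dots,n\}$ is a path set of $\phi$ if $\phi(x_1,\dots,x_n)=1$ whenever $x_i=1$ for all $i\in P$; it is a minimal path set if it does not contain another path set. If $P_1,\dots,P_r$ are the minimal path sets of $\phi$, then $\phi(x_1,\dots,x_n)=\max_{i=1,\dots,r}\min_{j\in P_i}x_j$. The same formula extends $\phi$ to a map $[0,\infty)^n\to[0,\infty)$, and the system lifetime is $$\phi(X_1,\dots,X_n)=\max_{i=1,\dots,r}\min_{j\in P_i}X_j .$$ Bivariate distortion function: a continuous function $D:[0,1]^2\to[0,1]$ that is the restriction to $[0,1]^2$ of a bivariate (probability) distribution function whose support is included in $[0,1]^2$. (It need not be a copula: its marginals need not be uniform.) Conventions: $\partial_1\psi$ denotes the partial derivative of $\psi$ with respect to its first variable. Whenever a conditional distribution or a partial derivative is used, it is assumed to exist. The conditional distribution of $T$ given $T_1=t$ is the usual one defined through densities (joint density of $(T_1,T)$ divided by the marginal density of $T_1$), so the formula for it is understood for almost every $t$ (with respect to the law of $T_1$), at which the marginal density of $T_1$ and the denominator $\partial_1\widehat D(\bar F(t),1)$ are nonzero. *)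

theory Defs
  imports "HOL-Probability.Probability"
begin

section \<open>Coherent systems\<close>

text \<open>Components are indexed by a finite type; the state space \<open>{0,1}\<close> is rendered
  by \<^typ>\<open>bool\<close>, with \<^const>\<open>True\<close> for a working component or system.\<close>

type_synonym 'n structure_function = "('n \<Rightarrow> bool) \<Rightarrow> bool"

definition coherent :: "'n structure_function \<Rightarrow> bool" where
  "coherent \<phi> \<longleftrightarrow>
     (\<forall>i x. mono (\<lambda>b. \<phi> (x(i := b)))) \<and>
     (\<forall>i. \<exists>x. \<forall>b. \<phi> (x(i := b)) = b)"

definition path_set :: "'n structure_function \<Rightarrow> 'n set \<Rightarrow> bool" where
  "path_set \<phi> P \<longleftrightarrow> (\<forall>x. (\<forall>i\<in>P. x i) \<longrightarrow> \<phi> x)"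

definition minimal_path_set :: "'n structure_function \<Rightarrow> 'n set \<Rightarrow> bool" where
  "minimal_path_set \<phi> P \<longleftrightarrow> path_set \<phi> P \<and> (\<forall>Q. path_set \<phi> Q \<and> Q \<subseteq> P \<longrightarrow> Q = P)"

text \<open>For coherent \<open>\<phi>\<close> there is a minimal path set and none of them is empty, so that
  \<^const>\<open>Max\<close> and \<^const>\<open>Min\<close> are applied to finite nonempty sets only.\<close>

definition system_lifetime :: "'n::finite structure_function \<Rightarrow> real ^ 'n \<Rightarrow> real" where
  "system_lifetime \<phi> x = Max ((\<lambda>P. Min ((\<lambda>j. x $ j) ` P)) ` {P. minimal_path_set \<phi> P})"

section \<open>Bivariate distortion functions\<close>

abbreviation unit_square :: "(real \<times> real) set" where
  "unit_square \<equiv> {0..1} \<times> {0..1}"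

definition measure_support :: "'a::topological_space measure \<Rightarrow> 'a set" where
  "measure_support \<mu> = {z. \<forall>U. open U \<and> z \<in> U \<longrightarrow> emeasure \<mu> U > 0}"

text \<open>A distortion function is represented by a total function of which only the values on
  the unit square are relevant.  Neither uniform marginals nor \<open>D (u, 0) = 0\<close> are required.\<close>

definition bivariate_distortion :: "(real \<times> real \<Rightarrow> real) \<Rightarrow> bool" where
  "bivariate_distortion D \<longleftrightarrow>
     continuous_on unit_square D \<and> D ` unit_square \<subseteq> {0..1} \<and>
     (\<exists>\<mu> :: (real \<times> real) measure. prob_space \<mu> \<and> sets \<mu> = sets borel \<and>
        measure_support \<mu> \<subseteq> unit_square \<and>
        (\<forall>u\<in>{0..1}. \<forall>v\<in>{0..1}. D (u, v) = measure \<mu> ({..u} \<times> {..v})))"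

text \<open>Partial derivative in the first variable of a function on the unit square.  Taking it
  within \<open>{0..1}\<close> (one-sided at the end points) makes it independent of the values outside.\<close>

definition has_partial1 :: "(real \<times> real \<Rightarrow> real) \<Rightarrow> real \<Rightarrow> real \<Rightarrow> bool" where
  "has_partial1 D u v \<longleftrightarrow> (\<lambda>w. D (w, v)) differentiable (at u within {0..1})"

definition partial1 :: "(real \<times> real \<Rightarrow> real) \<Rightarrow> real \<Rightarrow> real \<Rightarrow> real" where
  "partial1 D u v = vector_derivative (\<lambda>w. D (w, v)) (at u within {0..1})"

section \<open>Conditional distributions through densities\<close>

definition marginal1_density :: "(real \<times> real \<Rightarrow> real) \<Rightarrow> real \<Rightarrow> real" where
  "marginal1_density g t = (LINT z|lborel. g (t, z))"

definition cond_density :: "(real \<times> real \<Rightarrow> real) \<Rightarrow> real \<Rightarrow> real \<Rightarrow> real" where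
  "cond_density g t z = g (t, z) / marginal1_density g t"

text \<open>If \<open>g\<close> is a joint density of \<open>(S, T)\<close>, this is \<open>Pr(T > y | S = t)\<close>.\<close>

definition cond_reliability :: "(real \<times> real \<Rightarrow> real) \<Rightarrow> real \<Rightarrow> real \<Rightarrow> real" where
  "cond_reliability g t y = (LINT z:{y<..}|lborel. cond_density g t z)"

end

theory Submission
  imports Defs
begin

text \<open>
  A coherent lifetime always equals the lifetime of some component, so the law of \<open>T\<^sub>1\<close> or of \<open>T\<close>
  is at most \<open>n\<close> times the common component law.  Since \<open>Fbar (X\<^sub>i)\<close> is uniform on \<open>[0, 1]\<close>, the
  distribution function \<open>D\<close> of the vector \<open>(Fbar T\<^sub>1, Fbar T)\<close> is Lipschitz with
  constant \<open>n\<close> in each variable, and it satisfies \<open>D (Fbar x, Fbar y) = Pr(T\<^sub>1 > x, T > y)\<close> because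
  the values \<open>Fbar x\<close> and \<open>Fbar y\<close> are attained with probability zero.

  Differentiating this identity in \<open>x\<close> (Lebesgue differentiation from the right and the chain
  rule) gives \<open>f t * partial1 D (Fbar t) (Fbar y) = (LINT z:{y<..}|lborel. g (t, z))\<close> for almost
  every \<open>t\<close> and all \<open>y\<close>, where \<open>f\<close> is the density of a component and \<open>g\<close> that of \<open>(T\<^sub>1, T)\<close>.
  Letting \<open>Fbar y\<close> tend to \<open>0\<close> shows that the limit \<open>L\<close> is \<open>0\<close>.
\<close>

section \<open>Coherent systems\<close>

text \<open>Coherence gives monotonicity in one coordinate at a time; the induction switches the
  coordinates from \<open>x\<close> to \<open>y\<close> one by one.\<close>

lemma coherent_mono:
  fixes \<phi> :: "'n::finite structure_function"
  assumes "coherent \<phi>" and le: "\<And>i. x i \<Longrightarrow> y i" and "\<phi> x"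
  shows "\<phi> y"
proof -
  have "\<phi> (\<lambda>j. if j \<in> A then y j else x j)" if "finite A" for A
    using that
  proof induction
    case empty
    then show ?case using \<open>\<phi> x\<close> by simp
  next
    case (insert i A)
    let ?z = "\<lambda>j. if j \<in> A then y j else x j"
    have "mono (\<lambda>b. \<phi> (?z(i := b)))"
      using assms(1) unfolding coherent_def by blast
    moreover have "x i \<le> y i"
      using le by auto
    ultimately have "\<phi> (?z(i := x i)) \<le> \<phi> (?z(i := y i))"
      by (rule monoD)
    moreover have "?z(i := x i) = ?z"
      using insert.hyps by (auto simp: fun_eq_iff)
    moreover have "?z(i := y i) = (\<lambda>j. if j \<in> insert i A then y j else x j)"
      by (auto simp: fun_eq_iff)
    ultimately show ?case
      using insert by simp
  qed
  from this[of UNIV] show ?thesis by simp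
qed

lemma path_set_nonempty: "coherent \<phi> \<Longrightarrow> path_set \<phi> P \<Longrightarrow> P \<noteq> {}"
  unfolding coherent_def path_set_def by (metis empty_iff)

text \<open>Relevance of a component, read at \<open>b = True\<close>, provides a state in which the
  system works, and the all-working state dominates it.\<close>

lemma path_set_UNIV:
  fixes \<phi> :: "'n::finite structure_function"
  assumes "coherent \<phi>"
  shows "path_set \<phi> UNIV"
proof -
  obtain x i where "\<phi> (x(i := True))"
    using assms unfolding coherent_def by metis
  then have "\<phi> y" if "\<forall>i. y i" for y
    by (rule coherent_mono[OF assms, rotated]) (simp add: that)
  then show ?thesis
    by (simp add: path_set_def)
qed

lemma ex_minimal_path_set:
  fixes \<phi> :: "'n::finite structure_function"
  assumes "coherent \<phi>"
  shows "\<exists>P. minimal_path_set \<phi> P"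
proof -
  have "Collect (path_set \<phi>) \<noteq> {}"
    using path_set_UNIV[OF assms] by auto
  then obtain P where "P \<in> Collect (path_set \<phi>)" "\<forall>Q\<in>Collect (path_set \<phi>). Q \<subseteq> P \<longrightarrow> P = Q"
    using finite_has_minimal[of "Collect (path_set \<phi>)"] by auto
  then show ?thesis
    unfolding minimal_path_set_def by auto
qed

text \<open>Maximum and minimum over finite nonempty sets are attained. The index \<open>i\<close>
  depends on \<open>x\<close>.\<close>

lemma system_lifetime_eq_component:
  fixes \<phi> :: "'n::finite structure_function"
  assumes "coherent \<phi>"
  shows "\<exists>i. system_lifetime \<phi> x = x $ i"
proof -
  let ?A = "(\<lambda>P. Min ((\<lambda>j. x $ j) ` P)) ` {P. minimal_path_set \<phi> P}"
  have "Max ?A \<in> ?A"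
    using ex_minimal_path_set[OF assms] by (intro Max_in) auto
  then obtain P where P: "minimal_path_set \<phi> P" "Max ?A = Min ((\<lambda>j. x $ j) ` P)"
    by auto
  then have "P \<noteq> {}"
    using path_set_nonempty[OF assms] by (auto simp: minimal_path_set_def)
  then have "Min ((\<lambda>j. x $ j) ` P) \<in> (\<lambda>j. x $ j) ` P"
    by (intro Min_in) auto
  then show ?thesis
    using P(2) unfolding system_lifetime_def by auto
qed

section \<open>Measurability and null sets of coordinate projections\<close>

lemma measurable_vec_nth_borel [measurable]:
  "(\<lambda>x :: real ^ 'n::finite. x $ i) \<in> borel_measurable borel"
  by (intro borel_measurable_continuous_onI continuous_intros)

lemma borel_measurable_system_lifetime [measurable]:
  "system_lifetime (\<phi> :: 'n::finite structure_function) \<in> borel_measurable borel"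
  unfolding system_lifetime_def by measurable

text \<open>Lebesgue measure on the vector space is the image of a product of one-dimensional ones,
  and the preimage is a cylinder with \<open>N\<close> as one factor.\<close>

lemma null_sets_component_vimage:
  assumes "N \<in> null_sets (lborel :: real measure)"
  shows "{x :: real ^ 'n::finite. x $ i \<in> N} \<in> null_sets lborel"
proof -
  let ?e = "axis i 1 :: real ^ 'n"
  let ?P = "\<Pi>\<^sub>M b\<in>(Basis :: (real ^ 'n) set). (lborel :: real measure)"
  let ?s = "\<lambda>f. \<Sum>b\<in>Basis. f b *\<^sub>R (b :: real ^ 'n)"
  have e: "?e \<in> Basis"
    by (simp add: axis_in_Basis_iff)
  have N [measurable]: "N \<in> sets borel" "emeasure lborel N = 0"
    using assms by (auto simp: null_sets_def)
  have [measurable]: "{x :: real ^ 'n. x $ i \<in> N} \<in> sets borel"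
    by measurable
  have nth: "?s f $ i = f ?e" for f
  proof -
    have "?s f $ i = ?s f \<bullet> ?e"
      by (simp add: inner_axis)
    also have "\<dots> = f ?e"
      using e by (simp add: inner_sum_left inner_Basis if_distrib[of "\<lambda>x. _ * x"] cong: if_cong)
    finally show ?thesis .
  qed
  have s: "?s \<in> measurable ?P borel"
    by measurable
  interpret product_sigma_finite "\<lambda>_ :: real ^ 'n. lborel :: real measure" ..
  have "emeasure lborel {x :: real ^ 'n. x $ i \<in> N}
      = emeasure ?P (?s -` {x. x $ i \<in> N} \<inter> space ?P)"
    by (subst lborel_eq, subst emeasure_distr[OF s]) simp_all
  also have "?s -` {x. x $ i \<in> N} \<inter> space ?P
      = Pi\<^sub>E Basis (\<lambda>b. if b = ?e then N else UNIV)"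
    using e by (auto simp: nth space_PiM PiE_iff vimage_def simp del: sum_component dest!: bspec[OF _ e])
  also have "emeasure ?P \<dots> = (\<Prod>b\<in>Basis. emeasure lborel (if b = ?e then N else UNIV))"
    by (subst emeasure_PiM) auto
  \<comment> \<open>The other factors may be infinite, but in the extended nonnegative reals the
    zero factor still annihilates the product.\<close>
  also have "\<dots> = 0"
    using e N(2) by (intro prod_zero) auto
  finally show ?thesis
    by (simp add: null_sets_def)
qed

section \<open>Tail integrals and uniform transforms\<close>

text \<open>Along a sequence tending to \<open>y\<close> the indicators converge except at the
  single point \<open>y\<close>, and \<open>norm (q z)\<close> dominates.\<close>

lemma isCont_tail_integral:
  fixes q :: "real \<Rightarrow> real"
  assumes q: "integrable lborel q"
  shows "isCont (\<lambda>y. LINT z:{y<..}|lborel. q z) y"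
proof -
  have "(\<lambda>n. LINT z:{a n<..}|lborel. q z) \<longlonglongrightarrow> (LINT z:{y<..}|lborel. q z)"
    if a: "a \<longlonglongrightarrow> y" for a
    unfolding set_lebesgue_integral_def
  proof (rule integral_dominated_convergence[where w = "\<lambda>z. norm (q z)"])
    show "AE z in lborel. (\<lambda>n. indicator {a n<..} z *\<^sub>R q z) \<longlonglongrightarrow> indicator {y<..} z *\<^sub>R q z"
      using AE_lborel_singleton[of y]
    proof eventually_elim
      case (elim z)
      then consider "z < y" | "y < z" by linarith
      then have "\<forall>\<^sub>F n in sequentially. indicator {a n<..} z = (indicator {y<..} z :: real)"
      proof cases
        case 1
        then show ?thesis
          using order_tendstoD(1)[OF a 1] by (auto elim!: eventually_mono)
      next
        case 2
        then show ?thesis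
          using order_tendstoD(2)[OF a 2] by (auto elim!: eventually_mono)
      qed
      then show ?case
        by (intro tendsto_scaleR tendsto_eventually tendsto_const)
    qed
  qed (use q in \<open>auto split: split_indicator\<close>)
  then show ?thesis
    by (simp add: continuous_at_sequentially o_def)
qed

text \<open>Lebesgue differentiation for averages over \<open>[t, t + h]\<close> with
  \<open>h > 0\<close>; the sign comes from moving the lower limit. One-sided derivatives suffice
  later, since they are unique.\<close>

lemma AE_tail_integral_has_right_derivative:
  fixes q :: "real \<Rightarrow> real"
  assumes q: "integrable lborel q"
  shows "AE t in lborel.
    ((\<lambda>x. LINT z:{x<..}|lborel. q z) has_real_derivative - q t) (at t within {t..})"
proof -
  let ?Q = "\<lambda>x. LINT z:{x<..}|lborel. q z"
  have si: "set_integrable lborel A q" if "A \<in> sets borel" for A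
    using q that unfolding set_integrable_def by (intro integrable_mult_indicator) auto
  have "q integrable_on cbox a b" for a b
    using set_borel_integral_eq_integral(1)[OF si[of "cbox a b"]] by simp
  then obtain N where N: "negligible N"
    "\<And>x e. \<lbrakk>x \<notin> N; 0 < e\<rbrakk> \<Longrightarrow> \<exists>d>0. \<forall>h. 0 < h \<and> h < d \<longrightarrow>
        norm (integral (cbox x (x + h *\<^sub>R One)) q /\<^sub>R h ^ DIM(real) - q x) < e"
    by (rule integrable_ccontinuous_explicit) blast
  have diff: "?Q (t + h) - ?Q t = - integral {t..t + h} q" if "0 < h" for t h
  proof -
    have "?Q t = (LINT z:{t<..t + h} \<union> {t + h<..}|lborel. q z)"
      using that by (intro arg_cong[where f = "\<lambda>A. LINT z:A|lborel. q z"]) auto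
    also have "\<dots> = (LINT z:{t<..t + h}|lborel. q z) + ?Q (t + h)"
      by (intro set_integral_Un si) auto
    also have "(LINT z:{t<..t + h}|lborel. q z) = (LINT z:{t..t + h}|lborel. q z)"
      using AE_lborel_singleton[of t] unfolding set_lebesgue_integral_def
      by (intro integral_cong_AE)
         (use q in \<open>auto elim!: eventually_mono split: split_indicator\<close>)
    also have "\<dots> = integral {t..t + h} q"
      by (intro set_borel_integral_eq_integral(2) si) auto
    finally show ?thesis by simp
  qed
  have deriv: "(?Q has_real_derivative - q t) (at t within {t..})" if t: "t \<notin> N" for t
    unfolding has_field_derivative_iff Lim_within dist_norm
  proof (intro allI impI)
    fix e :: real
    assume "0 < e"
    from N(2)[OF t this] obtain d where d: "d > 0"
      "\<And>h. 0 < h \<Longrightarrow> h < d \<Longrightarrow> \<bar>integral {t..t + h} q / h - q t\<bar> < e"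
      by (auto simp: divide_inverse mult.commute)
    have "norm ((?Q y - ?Q t) / (y - t) - - q t) < e"
      if "y \<in> {t..}" "0 < norm (y - t) \<and> norm (y - t) < d" for y
      using that d(2)[of "y - t"] diff[of "y - t" t]
      by (simp add: abs_minus_commute)
    then show "\<exists>s>0. \<forall>y\<in>{t..}. 0 < norm (y - t) \<and> norm (y - t) < s \<longrightarrow>
        norm ((?Q y - ?Q t) / (y - t) - - q t) < e"
      using d(1) by blast
  qed
  \<comment> \<open>A negligible set is null for the completed measure; the conclusion is then
    carried back to \<open>lborel\<close>.\<close>
  have "AE t in lebesgue. t \<notin> N"
    using N(1) by (intro AE_not_in) (simp add: negligible_iff_null_sets)
  then have "AE t in lebesgue. (?Q has_real_derivative - q t) (at t within {t..})"
    by eventually_elim (rule deriv)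
  then show ?thesis
    by (simp add: AE_completion_iff)
qed

section \<open>The probability integral transform\<close>

text \<open>Intermediate value theorem: the tail tends to \<open>1\<close> on the left and to
  \<open>0\<close> on the right.\<close>

lemma ex_tail_eq:
  fixes \<nu> :: "real measure"
  assumes "real_distribution \<nu>"
    and cont: "\<And>x. isCont (\<lambda>x. measure \<nu> {x<..}) x"
    and u: "0 < u" "u < 1"
  shows "\<exists>x. measure \<nu> {x<..} = u"
proof -
  interpret real_distribution \<nu> by fact
  have cdf: "measure \<nu> {x<..} = 1 - cdf \<nu> x" for x
    using prob_compl[of "{..x}"] by (simp add: cdf_def Compl_eq_Diff_UNIV[symmetric])
  have "((\<lambda>x. measure \<nu> {x<..}) \<longlongrightarrow> 1 - 1) at_top" "((\<lambda>x. measure \<nu> {x<..}) \<longlongrightarrow> 1 - 0) at_bot"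
    unfolding cdf by (intro tendsto_intros cdf_lim_at_top_prob cdf_lim_at_bot)+
  then have "\<forall>\<^sub>F x in at_top. measure \<nu> {x<..} < u" "\<forall>\<^sub>F x in at_bot. u < measure \<nu> {x<..}"
    using u by (auto dest: order_tendstoD)
  then obtain a b where a: "u < measure \<nu> {a<..}" and b: "measure \<nu> {b<..} < u"
    using eventually_happens[of _ at_top] eventually_happens[of _ at_bot] trivial_limit_at_top_linorder
      trivial_limit_at_bot_linorder by metis
  have "a \<le> b"
    using a b finite_measure_mono[of "{a<..}" "{b<..}"] by fastforce
  then show ?thesis
    using IVT2'[of "\<lambda>x. measure \<nu> {x<..}" b u a] a b cont
    by (auto simp: continuous_at_imp_continuous_on)
qed

text \<open>The tail may be constant on intervals and thus have no inverse. For
  \<open>0 < u < 1\<close> the sublevel set is instead a closed half-line starting at its infimum,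
  where the tail equals \<open>u\<close>; absence of atoms makes its mass that tail.\<close>

lemma tail_transform_uniform:
  fixes \<nu> :: "real measure"
  assumes "real_distribution \<nu>"
    and cont: "\<And>x. isCont (\<lambda>x. measure \<nu> {x<..}) x"
    and u: "0 \<le> u" "u \<le> 1"
  shows "measure \<nu> {z. measure \<nu> {z<..} \<le> u} = u"
proof -
  interpret real_distribution \<nu> by fact
  define F where "F = (\<lambda>x. measure \<nu> {x<..})"
  have F_cdf: "F x = 1 - cdf \<nu> x" for x
    using prob_compl[of "{..x}"] by (simp add: F_def cdf_def Compl_eq_Diff_UNIV[symmetric])
  have anti: "F y \<le> F x" if "x \<le> y" for x y
    using cdf_nondecreasing[OF that] by (simp add: F_cdf)
  have F_cont: "isCont F x" for x
    using cont by (simp add: F_def)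
  then have F_cont_on: "continuous_on A F" for A
    by (simp add: continuous_at_imp_continuous_on)
  have F_meas [measurable]: "F \<in> borel_measurable borel"
    by (intro borel_measurable_continuous_onI F_cont_on)
  have atom: "measure \<nu> {x} = 0" for x
  proof -
    have "isCont (\<lambda>x. 1 - F x) x"
      by (intro continuous_intros F_cont)
    then show ?thesis
      using isCont_cdf[of x] by (simp add: F_cdf)
  qed
  have interior: "measure \<nu> {z. F z \<le> v} = v" if v: "0 < v" "v < 1" for v
  proof -
    let ?S = "{z. F z \<le> v}"
    obtain c where c: "F c = v"
      using ex_tail_eq[OF assms(1) cont v] by (auto simp: F_def)
    \<comment> \<open>The midpoint of \<open>v\<close> and \<open>1\<close> exceeds
      \<open>v\<close>, so \<open>a\<close> lies to the left of the whole sublevel set.\<close>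
    obtain a where a: "F a = (v + 1) / 2"
      using ex_tail_eq[OF assms(1) cont, of "(v + 1) / 2"] v by (auto simp: F_def)
    have lower: "a \<le> z" if "z \<in> ?S" for z
      using that a anti[of z a] v by (cases "a \<le> z") auto
    have bdd: "bdd_below ?S"
      using lower by (rule bdd_belowI)
    have "closed ?S"
      by (intro closed_Collect_le F_cont_on continuous_on_const)
    then have Inf: "Inf ?S \<in> ?S"
      using c bdd by (intro closed_contains_Inf) auto
    have S_eq: "?S = {Inf ?S..}"
      using Inf anti[of "Inf ?S"] by (fastforce intro: cInf_lower[OF _ bdd])
    have "F (Inf ?S) = v"
      using Inf anti[of "Inf ?S" c] cInf_lower[OF _ bdd, of c] c by force
    moreover have "measure \<nu> {x..} = F x" for x
    proof -
      have "measure \<nu> ({x} \<union> {x<..}) = measure \<nu> {x} + measure \<nu> {x<..}"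
        by (intro finite_measure_Union) auto
      moreover have "{x} \<union> {x<..} = {x..}"
        by auto
      ultimately show ?thesis
        by (simp add: F_def atom)
    qed
    ultimately show ?thesis
      by (subst S_eq) simp
  qed
  have sets: "{z. F z \<le> v} \<in> sets \<nu>" for v
    by simp
  have "measure \<nu> {z. F z \<le> u} = u"
  proof -
    consider "u = 0" | "0 < u" "u < 1" | "u = 1"
      using u by linarith
    then show ?thesis
    proof cases
      case 1
      \<comment> \<open>The value \<open>0\<close> need not be attained by \<open>F\<close>, so this
        case is squeezed by the sublevel sets for small \<open>v\<close>.\<close>
      have "measure \<nu> {z. F z \<le> 0} \<le> v" if "0 < v" "v < 1" for v
      proof -
        have "measure \<nu> {z. F z \<le> 0} \<le> measure \<nu> {z. F z \<le> v}"
          using that(1) by (intro finite_measure_mono sets) auto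
        then show ?thesis
          using interior[OF that] by simp
      qed
      then have "measure \<nu> {z. F z \<le> 0} \<le> 0"
        by (intro dense_ge_bounded[OF zero_less_one])
      then show ?thesis
        using 1 measure_nonneg[of \<nu> "{z. F z \<le> 0}"] by simp
    next
      case 2
      then show ?thesis by (rule interior)
    next
      case 3
      have "{z. F z \<le> u} = space \<nu>"
        using 3 by (auto simp: F_def)
      then show ?thesis
        using 3 prob_space by simp
    qed
  qed
  then show ?thesis
    by (simp add: F_def)
qed

text \<open>The lifetime is always one of the coordinates, so the event is covered by one event per
  component; the union bound then applies whatever their dependence.\<close>

lemma measure_system_lifetime_le:
  fixes X :: "'a \<Rightarrow> real ^ 'n::finite"
  assumes "prob_space M" and X [measurable]: "X \<in> borel_measurable M" and "coherent \<phi>"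
    and law: "\<And>i. distr M borel (\<lambda>\<omega>. X \<omega> $ i) = \<nu>" and A [measurable]: "A \<in> sets borel"
  shows "measure M {\<omega> \<in> space M. system_lifetime \<phi> (X \<omega>) \<in> A} \<le> CARD('n) * measure \<nu> A"
proof -
  interpret prob_space M by fact
  have "system_lifetime \<phi> (X \<omega>) \<in> A \<Longrightarrow> \<exists>i. X \<omega> $ i \<in> A" for \<omega>
    using system_lifetime_eq_component[OF \<open>coherent \<phi>\<close>, of "X \<omega>"] by force
  then have "measure M {\<omega> \<in> space M. system_lifetime \<phi> (X \<omega>) \<in> A}
      \<le> measure M (\<Union>i. {\<omega> \<in> space M. X \<omega> $ i \<in> A})"
    by (intro finite_measure_mono) auto
  also have "\<dots> \<le> (\<Sum>i\<in>UNIV. measure M {\<omega> \<in> space M. X \<omega> $ i \<in> A})"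
    by (intro finite_measure_subadditive_finite) auto
  also have "\<dots> = (\<Sum>i\<in>(UNIV :: 'n set). measure \<nu> A)"
  proof (rule sum.cong[OF refl])
    fix i
    show "measure M {\<omega> \<in> space M. X \<omega> $ i \<in> A} = measure \<nu> A"
      by (subst law[of i, symmetric], subst measure_distr)
         (auto intro!: arg_cong[where f = "measure M"])
  qed
  finally show ?thesis by simp
qed

section \<open>Rectangle probabilities from a joint density\<close>

text \<open>Fubini for \<open>g\<close> times the indicator of a rectangle; nonnegativity of
  \<open>g\<close> allows passing from \<open>ennreal\<close> densities to Bochner
  integrals.\<close>

lemma
  assumes "prob_space M" and g_nonneg: "\<And>z. 0 \<le> g z"
    and g: "distributed M lborel (\<lambda>\<omega>. (S \<omega>, T \<omega>)) (\<lambda>z :: real \<times> real. ennreal (g z))"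
  shows distributed_pair_integrable: "integrable lborel g"
    and distributed_pair_integrable_section: "B \<in> sets borel \<Longrightarrow>
      integrable lborel (\<lambda>t. LINT z:B|lborel. g (t, z))"
    and distributed_pair_measure: "A \<in> sets borel \<Longrightarrow> B \<in> sets borel \<Longrightarrow>
      measure M {\<omega> \<in> space M. S \<omega> \<in> A \<and> T \<omega> \<in> B}
        = (LINT t:A|lborel. LINT z:B|lborel. g (t, z))"
proof -
  interpret prob_space M by fact
  have ST: "(\<lambda>\<omega>. (S \<omega>, T \<omega>)) \<in> borel_measurable M"
    using distributed_measurable[OF g] by simp
  show int: "integrable lborel g"
    using distributed_integrable[OF g, of "\<lambda>_. 1"] g_nonneg by simp
  have int_rect: "integrable (lborel \<Otimes>\<^sub>M lborel) (\<lambda>z. g z * indicator (A \<times> B) z)"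
    if "A \<in> sets borel" "B \<in> sets borel" for A B :: "real set"
    using integrable_mult_indicator[of "A \<times> B" lborel g] int borel_Times[OF that]
    by (simp add: lborel_prod mult.commute)
  have slice: "(LINT z|lborel. g (t, z) * indicator (A \<times> B) (t, z))
      = indicator A t * (LINT z:B|lborel. g (t, z))" for A B t
    by (simp add: indicator_times set_lebesgue_integral_def mult_ac)
  show "integrable lborel (\<lambda>t. LINT z:B|lborel. g (t, z))" if "B \<in> sets borel"
    using lborel_pair.integrable_fst'[OF int_rect[of UNIV B]] that by (simp add: slice)
  show "measure M {\<omega> \<in> space M. S \<omega> \<in> A \<and> T \<omega> \<in> B}
      = (LINT t:A|lborel. LINT z:B|lborel. g (t, z))"
    if AB: "A \<in> sets borel" "B \<in> sets borel"
  proof -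
    have ind: "indicator (A \<times> B) \<in> borel_measurable (lborel :: (real \<times> real) measure)"
      using borel_Times[OF AB] by simp
    have ev: "{\<omega> \<in> space M. S \<omega> \<in> A \<and> T \<omega> \<in> B} = (\<lambda>\<omega>. (S \<omega>, T \<omega>)) -` (A \<times> B) \<inter> space M"
      by auto
    have "measure M {\<omega> \<in> space M. S \<omega> \<in> A \<and> T \<omega> \<in> B}
        = (LINT \<omega>|M. indicator {\<omega> \<in> space M. S \<omega> \<in> A \<and> T \<omega> \<in> B} \<omega>)"
      using measurable_sets[OF ST borel_Times[OF AB]] by (simp add: ev)
    also have "\<dots> = (LINT \<omega>|M. indicator (A \<times> B) (S \<omega>, T \<omega>))"
      by (intro Bochner_Integration.integral_cong) (auto split: split_indicator)
    also have "\<dots> = (LINT z|lborel. g z * indicator (A \<times> B) z)"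
      using distributed_integral[OF g ind] g_nonneg by simp
    also have "\<dots> = (LINT t|lborel. LINT z|lborel. g (t, z) * indicator (A \<times> B) (t, z))"
      using lborel_pair.integral_fst'[OF int_rect[OF AB]] by (simp add: lborel_prod)
    finally show ?thesis
      by (simp add: slice set_lebesgue_integral_def)
  qed
qed

section \<open>Right derivatives\<close>

lemma right_derivative_unique:
  fixes f :: "real \<Rightarrow> real"
  assumes "(f has_real_derivative a) (at t within {t..})" "(f has_real_derivative b) (at t within {t..})"
  shows "a = b"
  using assms unfolding has_field_derivative_iff
  by (rule tendsto_unique[rotated]) (simp add: at_within_Ici_at_right)

text \<open>The derivative \<open>- k y\<close> is monotone in \<open>y\<close>, so agreement with the continuous tail
  integral on the rationals forces agreement everywhere.\<close>

lemma right_derivative_eq_tail_integral: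
  fixes G :: "real \<Rightarrow> real \<Rightarrow> real"
  assumes q: "integrable lborel q"
    and rat: "\<And>y. y \<in> \<rat> \<Longrightarrow>
      ((\<lambda>x. G x y) has_real_derivative - (LINT z:{y<..}|lborel. q z)) (at t within {t..})"
    and k: "\<And>y. ((\<lambda>x. G x y) has_real_derivative - k y) (at t within {t..})"
    and mono: "\<And>x x' y y'. x \<le> x' \<Longrightarrow> y \<le> y' \<Longrightarrow> G x' y - G x' y' \<le> G x y - G x y'"
  shows "k y = (LINT z:{y<..}|lborel. q z)"
proof -
  let ?h = "\<lambda>y. LINT z:{y<..}|lborel. q z"
  have k_rat: "k r = ?h r" if "r \<in> \<rat>" for r
    using right_derivative_unique[OF rat[OF that] k] by simp
  \<comment> \<open>By \<open>mono\<close>, \<open>G x a - G x b\<close> does not increase with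
    \<open>x\<close>, so its right derivative \<open>k b - k a\<close> is nonpositive.\<close>
  have k_anti: "k b \<le> k a" if "a \<le> b" for a b
  proof -
    have "((\<lambda>x. G x a - G x b) has_real_derivative - k a - - k b) (at t within {t..})"
      by (intro DERIV_diff k)
    then have "((\<lambda>x. ((G x a - G x b) - (G t a - G t b)) / (x - t)) \<longlongrightarrow> - k a - - k b) (at t within {t..})"
      by (simp add: has_field_derivative_iff)
    moreover have "\<forall>\<^sub>F x in at t within {t..}. ((G x a - G x b) - (G t a - G t b)) / (x - t) \<le> 0"
      using mono[of t _ a b] that
      by (auto simp: eventually_at_filter intro!: always_eventually divide_nonpos_nonneg)
    ultimately have "- k a - - k b \<le> 0"
      by (rule tendsto_upperbound) (simp add: at_within_Ici_at_right)
    then show ?thesis by simp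
  qed
  have h_tendsto: "(?h \<longlongrightarrow> ?h y) (at y)"
    using isCont_tail_integral[OF q] by (simp add: isCont_def)
  show ?thesis
  proof (rule antisym; rule ccontr)
    assume "\<not> k y \<le> ?h y"
    then have "\<forall>\<^sub>F r in at y. ?h r < k y"
      by (intro order_tendstoD(2)[OF h_tendsto]) simp
    then obtain d where d: "d > 0" "\<And>r. r \<noteq> y \<Longrightarrow> dist r y < d \<Longrightarrow> ?h r < k y"
      unfolding eventually_at by auto
    \<comment> \<open>A rational on the left of \<open>y\<close> gives
      \<open>k y \<le> k r = ?h r < k y\<close>. The other case uses one on the right.\<close>
    obtain r where r: "r \<in> \<rat>" "y - d < r" "r < y"
      using Rats_dense_in_real[of "y - d" y] d(1) by auto
    then show False
      using d(2)[of r] k_rat[of r] k_anti[of r y] by (auto simp: dist_real_def)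
  next
    assume "\<not> ?h y \<le> k y"
    then have "\<forall>\<^sub>F r in at y. k y < ?h r"
      by (intro order_tendstoD(1)[OF h_tendsto]) simp
    then obtain d where d: "d > 0" "\<And>r. r \<noteq> y \<Longrightarrow> dist r y < d \<Longrightarrow> k y < ?h r"
      unfolding eventually_at by auto
    obtain r where r: "r \<in> \<rat>" "y < r" "r < y + d"
      using Rats_dense_in_real[of y "y + d"] d(1) by auto
    then show False
      using d(2)[of r] k_rat[of r] k_anti[of y r] by (auto simp: dist_real_def)
  qed
qed

text \<open>As \<open>F\<close> stays in \<open>[0, 1]\<close>, the derivative of \<open>D\<close>
  within that interval restricts to the image of \<open>{t..}\<close>, which is what the chain rule
  requires.\<close>

lemma has_partial1_chain:
  assumes D: "has_partial1 D (F t) v"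
    and F: "(F has_real_derivative - c) (at t within {t..})" "\<And>x. F x \<in> {0..1}"
  shows "((\<lambda>x. D (F x, v)) has_real_derivative - (c * partial1 D (F t) v)) (at t within {t..})"
proof -
  have "((\<lambda>w. D (w, v)) has_real_derivative partial1 D (F t) v) (at (F t) within {0..1})"
    using D unfolding has_partial1_def partial1_def
    by (simp add: vector_derivative_works has_real_derivative_iff_has_vector_derivative)
  then have "((\<lambda>w. D (w, v)) has_real_derivative partial1 D (F t) v) (at (F t) within F ` {t..})"
    by (rule DERIV_subset) (use F(2) in blast)
  from DERIV_image_chain[OF this F(1)] show ?thesis
    by (simp add: o_def mult.commute)
qed

section \<open>Pairs dominated by a univariate law\<close>

text \<open>Isolates what is kept of the systems: both lifetime laws are at most \<open>C\<close>
  times a law with density \<open>f\<close>. In the application \<open>C\<close> is the number of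
  components.\<close>

locale dominated_pair = prob_space M + \<nu>: real_distribution \<nu>
  for M :: "'a measure" and \<nu> :: "real measure" +
  fixes S T :: "'a \<Rightarrow> real" and C :: real and f :: "real \<Rightarrow> real"
  assumes S_measurable [measurable]: "S \<in> borel_measurable M"
    and T_measurable [measurable]: "T \<in> borel_measurable M"
    and prob_S_le: "A \<in> sets borel \<Longrightarrow> prob {\<omega> \<in> space M. S \<omega> \<in> A} \<le> C * measure \<nu> A"
    and prob_T_le: "A \<in> sets borel \<Longrightarrow> prob {\<omega> \<in> space M. T \<omega> \<in> A} \<le> C * measure \<nu> A"
    and f_integrable: "integrable lborel f"
    and f_nonneg: "0 \<le> f x"
    and \<nu>_density: "\<nu> = density lborel (\<lambda>x. ennreal (f x))"
begin

definition tail :: "real \<Rightarrow> real" where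
  "tail x = measure \<nu> {x<..}"

text \<open>As \<open>tail\<close> is decreasing, a distribution function of transformed lifetimes
  encodes a joint reliability function.\<close>

definition distortion :: "real \<times> real \<Rightarrow> real" where
  "distortion z = prob {\<omega> \<in> space M. tail (S \<omega>) \<le> fst z \<and> tail (T \<omega>) \<le> snd z}"

lemma f_measurable [measurable]: "f \<in> borel_measurable borel"
  using f_integrable by auto

lemma tail_eq_integral: "tail x = (LINT z:{x<..}|lborel. f z)"
proof -
  have "measure \<nu> {x<..} = (LINT z|\<nu>. indicator {x<..} z)"
    by simp
  also have "\<dots> = (LINT z|lborel. f z * indicator {x<..} z)"
    unfolding \<nu>_density by (subst integral_real_density) (auto simp: f_nonneg)
  finally show ?thesis
    by (simp add: tail_def set_lebesgue_integral_def mult.commute)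
qed

lemma isCont_tail: "isCont tail x"
  using isCont_tail_integral[OF f_integrable] unfolding tail_eq_integral[abs_def] .

lemma tail_measurable [measurable]: "tail \<in> borel_measurable borel"
  by (intro borel_measurable_continuous_onI continuous_at_imp_continuous_on) (simp add: isCont_tail)

lemma tail_antimono: "x \<le> y \<Longrightarrow> tail y \<le> tail x"
  unfolding tail_def by (intro \<nu>.finite_measure_mono) auto

lemma tail_bounds: "0 \<le> tail x" "tail x \<le> 1"
  by (simp_all add: tail_def)

lemma tail_lt_imp_less: "tail y < tail x \<Longrightarrow> x < y"
  using tail_antimono[of y x] by linarith

lemma measure_tail_le: "0 \<le> u \<Longrightarrow> u \<le> 1 \<Longrightarrow> measure \<nu> {z. tail z \<le> u} = u"
  using tail_transform_uniform[OF \<nu>.real_distribution_axioms, of u] isCont_tail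
  by (simp add: tail_def[abs_def])

lemma measure_tail_between:
  assumes "0 \<le> u" "u \<le> v" "v \<le> 1"
  shows "measure \<nu> {z. u < tail z \<and> tail z \<le> v} = v - u"
proof -
  have "{z. u < tail z \<and> tail z \<le> v} = {z. tail z \<le> v} - {z. tail z \<le> u}"
    by auto
  moreover have "measure \<nu> \<dots> = measure \<nu> {z. tail z \<le> v} - measure \<nu> {z. tail z \<le> u}"
    using assms by (intro \<nu>.finite_measure_Diff) auto
  ultimately show ?thesis
    using assms by (simp add: measure_tail_le)
qed

text \<open>A uniform variable has no atoms: a level set lies in strips of arbitrarily small mass.
  Level \<open>0\<close> leaves no room for a strip below it and uses the sublevel set.\<close>

lemma measure_tail_eq_0: "measure \<nu> {z. tail z = u} = 0"
proof -
  consider "u < 0 \<or> 1 < u" | "u = 0" | "0 < u" "u \<le> 1"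
    by linarith
  then show ?thesis
  proof cases
    case 1
    then have "{z. tail z = u} = {}"
      using tail_bounds by (auto simp: not_less[symmetric])
    then show ?thesis
      by simp
  next
    case 2
    have "measure \<nu> {z. tail z = u} \<le> measure \<nu> {z. tail z \<le> 0}"
      using 2 by (intro \<nu>.finite_measure_mono) auto
    then show ?thesis
      using measure_tail_le[of 0] measure_nonneg[of \<nu> "{z. tail z = u}"] by simp
  next
    case 3
    have "measure \<nu> {z. tail z = u} \<le> e" if "0 < e" "e < u" for e
    proof -
      have "measure \<nu> {z. tail z = u} \<le> measure \<nu> {z. u - e < tail z \<and> tail z \<le> u}"
        using that by (intro \<nu>.finite_measure_mono) auto
      also have "\<dots> = e"
        using measure_tail_between[of "u - e" u] that 3 by simp
      finally show ?thesis .
    qed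
    then have "measure \<nu> {z. tail z = u} \<le> 0"
      by (intro dense_ge_bounded[OF 3(1)])
    then show ?thesis
      using measure_nonneg[of \<nu> "{z. tail z = u}"] by simp
  qed
qed

lemma AE_tail_neq:
  "AE \<omega> in M. tail (S \<omega>) \<noteq> u" "AE \<omega> in M. tail (T \<omega>) \<noteq> u"
proof -
  have "prob {\<omega> \<in> space M. tail (S \<omega>) = u} = 0" "prob {\<omega> \<in> space M. tail (T \<omega>) = u} = 0"
    using prob_S_le[of "{z. tail z = u}"] prob_T_le[of "{z. tail z = u}"]
    by (simp_all add: measure_tail_eq_0 measure_le_0_iff)
  then show "AE \<omega> in M. tail (S \<omega>) \<noteq> u" "AE \<omega> in M. tail (T \<omega>) \<noteq> u"
    by (auto simp: prob_eq_0)
qed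

lemma ex_tail: "0 < u \<Longrightarrow> u < 1 \<Longrightarrow> \<exists>x. tail x = u"
  using ex_tail_eq[OF \<nu>.real_distribution_axioms, of u] isCont_tail by (simp add: tail_def[abs_def])

lemma tail_le_iff_less: "tail z \<noteq> tail x \<Longrightarrow> tail z \<le> tail x \<longleftrightarrow> x < z"
  using tail_antimono[of x z] tail_antimono[of z x] by linarith

text \<open>The two events can differ only where \<open>tail (S \<omega>) = tail x\<close> or
  \<open>tail (T \<omega>) = tail y\<close>, which has probability zero by domination.\<close>

lemma joint_tail: "prob {\<omega> \<in> space M. x < S \<omega> \<and> y < T \<omega>} = distortion (tail x, tail y)"
  unfolding distortion_def
proof (rule finite_measure_eq_AE)
  show "AE \<omega> in M. \<omega> \<in> {\<omega> \<in> space M. x < S \<omega> \<and> y < T \<omega>} \<longleftrightarrow>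
    \<omega> \<in> {\<omega> \<in> space M. tail (S \<omega>) \<le> fst (tail x, tail y) \<and> tail (T \<omega>) \<le> snd (tail x, tail y)}"
    using AE_tail_neq(1)[of "tail x"] AE_tail_neq(2)[of "tail y"]
    by eventually_elim (auto simp: tail_le_iff_less)
qed measurable

lemma distortion_second_zero: "distortion (w, 0) = 0"
proof -
  have pos: "\<not> tail x \<le> 0" if "tail x \<noteq> 0" for x
    using tail_bounds(1)[of x] that by linarith
  have "distortion (w, 0) = prob {}"
    unfolding distortion_def
  proof (rule finite_measure_eq_AE)
    show "AE \<omega> in M. \<omega> \<in> {\<omega> \<in> space M. tail (S \<omega>) \<le> fst (w, 0) \<and> tail (T \<omega>) \<le> snd (w, 0 :: real)}
        \<longleftrightarrow> \<omega> \<in> {}"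
      using AE_tail_neq(2)[of 0]
      by eventually_elim (simp add: pos)
  qed auto
  then show ?thesis
    by simp
qed

section \<open>The distortion axioms\<close>

lemma C_nonneg: "0 \<le> C"
  using prob_S_le[of UNIV] \<nu>.prob_space prob_space by (simp add: \<nu>.events_eq_borel[THEN sets_eq_imp_space_eq])

text \<open>Passing from \<open>(u', v')\<close> to \<open>(u, v)\<close> adds at most two strips,
  and a strip of width \<open>d\<close> has probability at most \<open>C * d\<close> by domination
  and uniformity. Exchanging the points gives the Lipschitz bound.\<close>

lemma distortion_le:
  assumes "u \<in> {0..1}" "v \<in> {0..1}" "u' \<in> {0..1}" "v' \<in> {0..1}"
  shows "distortion (u, v) \<le> distortion (u', v') + C * (\<bar>u - u'\<bar> + \<bar>v - v'\<bar>)"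
proof -
  let ?A = "{z. u' < tail z \<and> tail z \<le> u}" and ?B = "{z. v' < tail z \<and> tail z \<le> v}"
  have between: "measure \<nu> {z. b < tail z \<and> tail z \<le> a} \<le> \<bar>a - b\<bar>" if "a \<in> {0..1}" "b \<in> {0..1}" for a b
  proof (cases "b \<le> a")
    case True
    then show ?thesis
      using that by (subst measure_tail_between) auto
  next
    case False
    then have empty: "{z. b < tail z \<and> tail z \<le> a} = {}"
      by auto
    show ?thesis
      unfolding empty by simp
  qed
  have "distortion (u, v) \<le> prob ({\<omega> \<in> space M. tail (S \<omega>) \<le> u' \<and> tail (T \<omega>) \<le> v'}
      \<union> ({\<omega> \<in> space M. S \<omega> \<in> ?A} \<union> {\<omega> \<in> space M. T \<omega> \<in> ?B}))"
    unfolding distortion_def by (intro finite_measure_mono) auto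
  also have "\<dots> \<le> distortion (u', v') + prob ({\<omega> \<in> space M. S \<omega> \<in> ?A} \<union> {\<omega> \<in> space M. T \<omega> \<in> ?B})"
    unfolding distortion_def fst_conv snd_conv
    by (intro measure_Un_le) auto
  also have "prob ({\<omega> \<in> space M. S \<omega> \<in> ?A} \<union> {\<omega> \<in> space M. T \<omega> \<in> ?B})
      \<le> prob {\<omega> \<in> space M. S \<omega> \<in> ?A} + prob {\<omega> \<in> space M. T \<omega> \<in> ?B}"
    by (intro measure_Un_le) auto
  also have "\<dots> \<le> C * measure \<nu> ?A + C * measure \<nu> ?B"
    by (intro add_mono prob_S_le prob_T_le) auto
  also have "\<dots> \<le> C * \<bar>u - u'\<bar> + C * \<bar>v - v'\<bar>"
    using C_nonneg assms by (intro add_mono mult_left_mono between) auto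
  finally show ?thesis
    by (simp add: distrib_left)
qed

lemma continuous_on_distortion: "continuous_on unit_square distortion"
proof -
  \<comment> \<open>Each of the two coordinate differences is at most \<open>dist p q\<close>,
    whence the factor \<open>2\<close>.\<close>
  have "(2 * C)-lipschitz_on unit_square distortion"
  proof (rule lipschitz_onI)
    fix p q :: "real \<times> real"
    assume "p \<in> unit_square" "q \<in> unit_square"
    then have "\<bar>distortion p - distortion q\<bar> \<le> C * (\<bar>fst p - fst q\<bar> + \<bar>snd p - snd q\<bar>)"
      using distortion_le[of "fst p" "snd p" "fst q" "snd q"]
        distortion_le[of "fst q" "snd q" "fst p" "snd p"]
      by (auto simp: abs_minus_commute)
    also have "\<dots> \<le> C * (dist p q + dist p q)"
      using dist_fst_le[of p q] dist_snd_le[of p q] C_nonneg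
      by (intro mult_left_mono add_mono) (auto simp: dist_real_def)
    finally show "dist (distortion p) (distortion q) \<le> 2 * C * dist p q"
      by (simp add: dist_real_def)
  qed (use C_nonneg in simp)
  then show ?thesis
    by (rule lipschitz_on_continuous_on)
qed

text \<open>The required measure is the law of the transformed pair. The complement of the square is
  open with empty preimage, so it contains no support point.\<close>

lemma bivariate_distortion: "bivariate_distortion distortion"
proof -
  let ?V = "\<lambda>\<omega>. (tail (S \<omega>), tail (T \<omega>))"
  define \<mu> where "\<mu> = distr M (borel :: (real \<times> real) measure) ?V"
  have V [measurable]: "?V \<in> borel_measurable M"
    by (simp add: borel_prod[symmetric])
  have "prob_space \<mu>"
    unfolding \<mu>_def by (rule prob_space_distr) (rule V)
  moreover have "measure_support \<mu> \<subseteq> unit_square"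
  proof
    fix z
    assume z: "z \<in> measure_support \<mu>"
    show "z \<in> unit_square"
    proof (rule ccontr)
      assume "z \<notin> unit_square"
      moreover have op: "open (- unit_square)"
        by (intro open_Compl closed_Times closed_atLeastAtMost)
      ultimately have "emeasure \<mu> (- unit_square) > 0"
        using z unfolding measure_support_def by blast
      moreover have "emeasure \<mu> (- unit_square) = emeasure M (?V -` (- unit_square) \<inter> space M)"
        unfolding \<mu>_def using V op by (intro emeasure_distr borel_open) auto
      moreover have "?V -` (- unit_square) \<inter> space M = {}"
        using tail_bounds by auto
      ultimately show False
        by simp
    qed
  qed
  moreover have "distortion (u, v) = measure \<mu> ({..u} \<times> {..v})" for u v
  proof -
    have "{..u} \<times> {..v} \<in> sets (borel :: (real \<times> real) measure)"
      by (intro borel_closed closed_Times closed_atMost)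
    then show ?thesis
      unfolding \<mu>_def distortion_def using V
      by (subst measure_distr) (auto intro!: arg_cong[where f = prob])
  qed
  moreover have "sets \<mu> = sets borel"
    by (simp add: \<mu>_def)
  moreover have "distortion ` unit_square \<subseteq> {0..1}"
    by (auto simp: distortion_def)
  ultimately show ?thesis
    unfolding bivariate_distortion_def using continuous_on_distortion by blast
qed

text \<open>The edge \<open>v = 1\<close> is treated apart from \<open>joint_tail\<close> because
  \<open>tail\<close> need not attain \<open>1\<close>.\<close>

lemma distortion_second_one: "distortion (tail x, 1) = prob {\<omega> \<in> space M. x < S \<omega>}"
  unfolding distortion_def
proof (rule finite_measure_eq_AE)
  show "AE \<omega> in M. \<omega> \<in> {\<omega> \<in> space M. tail (S \<omega>) \<le> fst (tail x, 1) \<and> tail (T \<omega>) \<le> snd (tail x, 1)}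
      \<longleftrightarrow> \<omega> \<in> {\<omega> \<in> space M. x < S \<omega>}"
    using AE_tail_neq(1)[of "tail x"]
    by eventually_elim (auto simp: tail_le_iff_less tail_bounds)
qed auto

section \<open>The conditional reliability function\<close>

lemma AE_distr_S:
  assumes "AE t in \<nu>. P t"
  shows "AE t in distr M borel S. P t"
proof -
  obtain N where N: "N \<in> null_sets \<nu>" "\<And>t. t \<in> space \<nu> - N \<Longrightarrow> P t"
    using AE_E3[OF assms] by metis
  have [measurable]: "N \<in> sets borel" and "measure \<nu> N = 0"
    using N(1) by (auto simp: null_sets_def measure_def)
  then have "prob {\<omega> \<in> space M. S \<omega> \<in> N} = 0"
    using prob_S_le[of N] by (simp add: measure_le_0_iff)
  then have "N \<in> null_sets (distr M borel S)"
    by (auto simp: null_sets_def emeasure_distr emeasure_eq_measure vimage_def Int_def conj_commute)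
  then show ?thesis
    by (rule AE_I') (use N(2) in auto)
qed

lemma AE_lborel_distr_S:
  assumes "AE t in lborel. P t"
  shows "AE t in distr M borel S. P t"
  by (rule AE_distr_S, subst \<nu>_density) (use assms in \<open>auto simp: AE_density\<close>)

text \<open>Two right derivatives of the same function are compared, one from the joint density and
  one from the chain rule. The exceptional set of \<open>t\<close> must not depend on
  \<open>y\<close> or \<open>L\<close>, so all almost-everywhere facts are collected before these
  are fixed.\<close>

lemma conditional_reliability:
  assumes g_nonneg: "\<And>z. 0 \<le> g z"
    and g: "distributed M lborel (\<lambda>\<omega>. (S \<omega>, T \<omega>)) (\<lambda>z. ennreal (g z))"
  shows "AE t in distr M borel S. \<forall>L.
    (\<forall>v\<in>{0<..1}. has_partial1 distortion (tail t) v) \<and>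
    ((\<lambda>v. partial1 distortion (tail t) v) \<longlongrightarrow> L) (at_right 0) \<longrightarrow>
      marginal1_density g t \<noteq> 0 \<and> partial1 distortion (tail t) 1 \<noteq> 0 \<and>
      (\<forall>y. cond_reliability g t y
         = (partial1 distortion (tail t) (tail y) - L) / partial1 distortion (tail t) 1)"
proof -
  note g_pair = prob_space_axioms g_nonneg g
  define h where "h t y = (LINT z:{y<..}|lborel. g (t, z))" for t y
  define m where "m = marginal1_density g"
  have m_eq: "m t = (LINT z:UNIV|lborel. g (t, z))" for t
    by (simp add: m_def marginal1_density_def set_lebesgue_integral_def)
  have m_int: "integrable lborel m"
    unfolding m_eq[abs_def] by (rule distributed_pair_integrable_section[OF g_pair]) simp
  have [measurable]: "m \<in> borel_measurable borel"
    using m_int by auto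
  \<comment> \<open>Countably many exceptional null sets can be united, hence rational
    \<open>y\<close> only; the remaining \<open>y\<close> follow by monotonicity and
    continuity.\<close>
  have "AE t in lborel. \<forall>y\<in>\<rat>.
      ((\<lambda>x. distortion (tail x, tail y)) has_real_derivative - h t y) (at t within {t..})"
  proof (rule AE_ball_countable'[OF _ countable_rat])
    fix y :: real
    have "distortion (tail x, tail y) = (LINT t:{x<..}|lborel. h t y)" for x
      using distributed_pair_measure[OF g_pair, of "{x<..}" "{y<..}"]
      by (simp add: joint_tail[symmetric] h_def)
    moreover have "integrable lborel (\<lambda>t. h t y)"
      unfolding h_def by (rule distributed_pair_integrable_section[OF g_pair]) simp
    ultimately show "AE t in lborel.
        ((\<lambda>x. distortion (tail x, tail y)) has_real_derivative - h t y) (at t within {t..})"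
      using AE_tail_integral_has_right_derivative by simp
  qed
  moreover have "AE t in lborel.
      ((\<lambda>x. distortion (tail x, 1)) has_real_derivative - m t) (at t within {t..})"
  proof -
    have "distortion (tail x, 1) = (LINT t:{x<..}|lborel. m t)" for x
      using distributed_pair_measure[OF g_pair, of "{x<..}" UNIV]
      by (simp add: distortion_second_one m_eq)
    then show ?thesis
      using AE_tail_integral_has_right_derivative[OF m_int] by simp
  qed
  moreover have "AE t in lborel. (tail has_real_derivative - f t) (at t within {t..})"
    using AE_tail_integral_has_right_derivative[OF f_integrable]
    unfolding tail_eq_integral[symmetric] .
  moreover have "AE t in lborel. integrable lborel (\<lambda>z. g (t, z))"
    using distributed_pair_integrable[OF g_pair] by (intro lborel_pair.AE_integrable_fst') (simp add: lborel_prod)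
  \<comment> \<open>If \<open>tail\<close> reaches \<open>0\<close> at a finite point, no
    \<open>y\<close> with \<open>tail y > 0\<close> lies beyond it; the density must vanish there
    for the limit \<open>L\<close> to be \<open>0\<close>.\<close>
  moreover have "AE t in lborel. AE z in lborel. tail z = 0 \<longrightarrow> g (t, z) = 0"
  proof -
    have "(\<lambda>z :: real \<times> real. tail (snd z)) \<in> borel_measurable borel"
      by (simp add: borel_prod[symmetric])
    then have "Measurable.pred lborel (\<lambda>z :: real \<times> real. tail (snd z) \<noteq> 0)"
      by measurable
    from distributed_AE2[OF g this] have "AE z in lborel. 0 < g z \<longrightarrow> tail (snd z) \<noteq> 0"
      using AE_tail_neq(2)[of 0] by simp
    then have "AE z in lborel \<Otimes>\<^sub>M lborel. tail (snd z) = 0 \<longrightarrow> g z = 0"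
      unfolding lborel_prod
      by eventually_elim (use g_nonneg in \<open>auto simp: less_le\<close>)
    then show ?thesis
      by (auto dest: lborel_pair.AE_pair)
  qed
  ultimately have lborel: "AE t in lborel.
      (\<forall>y\<in>\<rat>. ((\<lambda>x. distortion (tail x, tail y)) has_real_derivative - h t y) (at t within {t..})) \<and>
      ((\<lambda>x. distortion (tail x, 1)) has_real_derivative - m t) (at t within {t..}) \<and>
      (tail has_real_derivative - f t) (at t within {t..}) \<and>
      integrable lborel (\<lambda>z. g (t, z)) \<and> (AE z in lborel. tail z = 0 \<longrightarrow> g (t, z) = 0)"
    by eventually_elim blast
  have f_neq: "AE t in distr M borel S. f t \<noteq> 0"
    by (rule AE_distr_S, subst \<nu>_density) (auto simp: AE_density)
  \<comment> \<open>The probability of the zero set of the marginal density is the integral of that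
    density over its own zero set.\<close>
  have "AE \<omega> in M. m (S \<omega>) \<noteq> 0"
  proof -
    have "prob {\<omega> \<in> space M. m (S \<omega>) = 0} = (LINT t:{t. m t = 0}|lborel. m t)"
      using distributed_pair_measure[OF g_pair, of "{t. m t = 0}" UNIV]
      by (simp add: m_eq[symmetric])
    also have "\<dots> = (LINT t :: real|lborel. 0 :: real)"
      unfolding set_lebesgue_integral_def
      by (intro Bochner_Integration.integral_cong) (auto split: split_indicator)
    finally show ?thesis
      by (auto simp: prob_eq_0)
  qed
  then have m_neq: "AE t in distr M borel S. m t \<noteq> 0"
    by (subst AE_distr_iff) auto
  show ?thesis
    using AE_lborel_distr_S[OF lborel] f_neq m_neq
  proof (eventually_elim, intro allI impI, elim conjE)
    fix t L
    let ?p = "partial1 distortion (tail t)"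
    assume rat: "\<forall>y\<in>\<rat>. ((\<lambda>x. distortion (tail x, tail y)) has_real_derivative - h t y) (at t within {t..})"
      and one: "((\<lambda>x. distortion (tail x, 1)) has_real_derivative - m t) (at t within {t..})"
      and tail: "(tail has_real_derivative - f t) (at t within {t..})"
      and gt: "integrable lborel (\<lambda>z. g (t, z))"
      and zero: "AE z in lborel. tail z = 0 \<longrightarrow> g (t, z) = 0"
      and f0: "f t \<noteq> 0" and m0: "m t \<noteq> 0"
      and part: "\<forall>v\<in>{0<..1}. has_partial1 distortion (tail t) v"
      and L: "(?p \<longlongrightarrow> L) (at_right 0)"
    \<comment> \<open>The hypothesis covers \<open>v > 0\<close>, but \<open>tail y\<close> may be
      \<open>0\<close>; there the distortion is constantly \<open>0\<close> in its first
      argument.\<close>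
    have "has_partial1 distortion (tail t) 0"
      unfolding has_partial1_def distortion_second_zero by simp
    then have part': "has_partial1 distortion (tail t) v" if "v \<in> {0..1}" for v
      using part that by (cases "v = 0") auto
    have chain: "((\<lambda>x. distortion (tail x, v)) has_real_derivative - (f t * ?p v)) (at t within {t..})"
      if "v \<in> {0..1}" for v
      using tail_bounds by (intro has_partial1_chain part' that tail) auto
    have h: "f t * ?p (tail y) = h t y" for y
      unfolding h_def
    proof (rule right_derivative_eq_tail_integral[OF gt,
        where G = "\<lambda>x y. distortion (tail x, tail y)" and k = "\<lambda>y. f t * ?p (tail y)"])
      fix y :: real
      show "((\<lambda>x. distortion (tail x, tail y)) has_real_derivative - (f t * ?p (tail y))) (at t within {t..})"
        using tail_bounds by (intro chain) auto
    next
      fix x x' y y' :: real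
      assume le: "x \<le> x'" "y \<le> y'"
      \<comment> \<open>Written as the probability of a strip event, the difference visibly
        decreases as \<open>x\<close> grows.\<close>
      have strip: "distortion (tail x, tail y) - distortion (tail x, tail y')
          = prob {\<omega> \<in> space M. x < S \<omega> \<and> y < T \<omega> \<and> T \<omega> \<le> y'}" for x
      proof -
        have "{\<omega> \<in> space M. x < S \<omega> \<and> y < T \<omega> \<and> T \<omega> \<le> y'}
            = {\<omega> \<in> space M. x < S \<omega> \<and> y < T \<omega>} - {\<omega> \<in> space M. x < S \<omega> \<and> y' < T \<omega>}"
          by auto
        also have "prob \<dots> = prob {\<omega> \<in> space M. x < S \<omega> \<and> y < T \<omega>}
            - prob {\<omega> \<in> space M. x < S \<omega> \<and> y' < T \<omega>}"
          using le(2) by (intro finite_measure_Diff) auto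
        finally show ?thesis
          by (simp add: joint_tail)
      qed
      show "distortion (tail x', tail y) - distortion (tail x', tail y')
          \<le> distortion (tail x, tail y) - distortion (tail x, tail y')"
        unfolding strip using le(1) by (intro finite_measure_mono) auto
    qed (use rat in \<open>simp add: h_def\<close>)
    have m: "m t = f t * ?p 1"
      using right_derivative_unique[OF one chain] by simp
    then have p1: "?p 1 \<noteq> 0"
      using m0 by auto
    have "L = 0"
    proof -
      \<comment> \<open>The second \<open>Suc\<close> keeps \<open>v n\<close> strictly below
        \<open>1\<close>, so that it is a value of \<open>tail\<close>.\<close>
      define v where "v n = inverse (real (Suc (Suc n)))" for n
      have v_bounds: "0 < v n" "v n < 1" for n
        by (auto simp: v_def inverse_eq_divide)
      have v_lim: "v \<longlonglongrightarrow> 0"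
        unfolding v_def by (rule LIMSEQ_Suc[OF LIMSEQ_inverse_real_of_nat])
      obtain y where y: "\<And>n. tail (y n) = v n"
        using ex_tail[OF v_bounds] by metis
      have "filterlim v (at_right 0) sequentially"
        using v_bounds by (intro tendsto_imp_filterlim_at_right v_lim) simp
      from filterlim_compose[OF L this] have "(\<lambda>n. f t * ?p (v n)) \<longlonglongrightarrow> f t * L"
        by (rule tendsto_mult_left)
      then have "(\<lambda>n. h t (y n)) \<longlonglongrightarrow> f t * L"
        by (simp add: h[symmetric] y)
      moreover have "(\<lambda>n. h t (y n)) \<longlonglongrightarrow> (LINT (z :: real)|lborel. 0 :: real)"
        unfolding h_def set_lebesgue_integral_def
      proof (rule integral_dominated_convergence[where w = "\<lambda>z. norm (g (t, z))"])
        show "AE z in lborel. (\<lambda>n. indicator {y n<..} z *\<^sub>R g (t, z)) \<longlonglongrightarrow> 0"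
          using zero
        proof eventually_elim
          case (elim z)
          show ?case
          proof (cases "tail z = 0")
            case True
            then show ?thesis
              using elim by simp
          next
            \<comment> \<open>Once \<open>v n\<close> drops below \<open>tail z\<close>, the point
              \<open>z\<close> lies to the left of \<open>y n\<close> and leaves the domain of
              integration.\<close>
            case False
            then have "0 < tail z"
              using tail_bounds(1)[of z] by simp
            then have "\<forall>\<^sub>F n in sequentially. v n < tail z"
              by (rule order_tendstoD(2)[OF v_lim])
            then have "\<forall>\<^sub>F n in sequentially. indicator {y n<..} z *\<^sub>R g (t, z) = 0"
            proof eventually_elim
              case (elim n)
              then have "z < y n"
                unfolding y[symmetric] by (rule tail_lt_imp_less)
              then show ?case by simp
            qed
            then show ?thesis
              by (rule tendsto_eventually)
          qed
        qed
      qed (use gt in \<open>auto split: split_indicator\<close>)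
      ultimately have "f t * L = (LINT (z :: real)|lborel. 0 :: real)"
        by (rule LIMSEQ_unique)
      then show ?thesis
        using f0 by simp
    qed
    moreover have "cond_reliability g t y = ?p (tail y) / ?p 1" for y
    proof -
      have "cond_reliability g t y = h t y / m t"
        unfolding cond_reliability_def cond_density_def h_def m_def by simp
      \<comment> \<open>Numerator and denominator both carry the factor \<open>f t\<close>, which
        cancels.\<close>
      then show ?thesis
        using f0 by (simp add: m h[symmetric])
    qed
    ultimately show "marginal1_density g t \<noteq> 0 \<and> ?p 1 \<noteq> 0 \<and>
        (\<forall>y. cond_reliability g t y = (?p (tail y) - L) / ?p 1)"
      using m0 p1 by (simp add: m_def)
  qed
qed

end

section \<open>Absolutely continuous component laws\<close>

lemma absolutely_continuous_component:
  fixes X :: "'a \<Rightarrow> real ^ 'n::finite"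
  assumes X [measurable]: "X \<in> borel_measurable M"
    and ac: "absolutely_continuous lborel (distr M borel X)"
  shows "absolutely_continuous lborel (distr M borel (\<lambda>\<omega>. X \<omega> $ i))"
  unfolding absolutely_continuous_def
proof
  fix N :: "real set"
  assume N: "N \<in> null_sets lborel"
  then have [measurable]: "N \<in> sets borel"
    by auto
  have "{x. x $ i \<in> N} \<in> null_sets (distr M borel X)"
    using null_sets_component_vimage[OF N] ac unfolding absolutely_continuous_def by blast
  then show "N \<in> null_sets (distr M borel (\<lambda>\<omega>. X \<omega> $ i))"
    by (auto simp: null_sets_def emeasure_distr vimage_def)
qed

text \<open>Radon-Nikodym with a real-valued version of the derivative; finite total mass makes it
  integrable.\<close>

lemma real_density_exists:
  fixes \<nu> :: "real measure"
  assumes "real_distribution \<nu>" and ac: "absolutely_continuous lborel \<nu>"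
  obtains f where "integrable lborel f" "\<And>x. 0 \<le> f x" "\<nu> = density lborel (\<lambda>x. ennreal (f x))"
proof -
  interpret real_distribution \<nu> by fact
  have sets: "sets \<nu> = sets lborel"
    by simp
  obtain f where f [measurable]: "f \<in> borel_measurable lborel"
    and RN: "AE x in lborel. RN_deriv lborel \<nu> x = ennreal (f x)" and nonneg: "\<And>x. 0 \<le> f x"
    using sigma_finite_measure.real_RN_deriv[OF sigma_finite_lborel finite_measure_axioms ac sets] by metis
  have "\<nu> = density lborel (RN_deriv lborel \<nu>)"
    using sigma_finite_measure.density_RN_deriv[OF sigma_finite_lborel ac sets] by simp
  also have "\<dots> = density lborel (\<lambda>x. ennreal (f x))"
    using RN by (intro density_cong) auto
  finally have dens: "\<nu> = density lborel (\<lambda>x. ennreal (f x))" .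
  have "(\<integral>\<^sup>+x. ennreal (f x) \<partial>lborel) = emeasure \<nu> UNIV"
    by (subst dens) (simp add: emeasure_density)
  then have "integrable lborel f"
    using nonneg by (intro integrableI_nonneg) (simp_all add: emeasure_eq_measure)
  then show thesis
    using nonneg dens by (rule that)
qed

section \<open>Joint and conditional reliability of two coherent systems\<close>

theorem theorem3p1:
  fixes M :: "'a measure"
    and X :: "'a \<Rightarrow> real ^ 'n"
    and Fbar :: "real \<Rightarrow> real"
    and \<phi>\<^sub>1 \<phi> :: "'n structure_function"
    and T\<^sub>1 T :: "'a \<Rightarrow> real"
  assumes "prob_space M"
    and "X \<in> borel_measurable M"
    and "AE \<omega> in M. \<forall>i. 0 \<le> X \<omega> $ i"
    and "absolutely_continuous lborel (distr M borel X)"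
    and "\<And>i x. \<P>(\<omega> in M. X \<omega> $ i > x) = Fbar x"
    and "coherent \<phi>\<^sub>1" and "coherent \<phi>"
    and "\<And>\<omega>. T\<^sub>1 \<omega> = system_lifetime \<phi>\<^sub>1 (X \<omega>)"
    and "\<And>\<omega>. T \<omega> = system_lifetime \<phi> (X \<omega>)"
    and "AE \<omega> in M. T\<^sub>1 \<omega> < T \<omega>"
    and "absolutely_continuous lborel (distr M borel (\<lambda>\<omega>. (T\<^sub>1 \<omega>, T \<omega>)))"
  shows "\<exists>D. bivariate_distortion D \<and>
    (\<forall>x y. \<P>(\<omega> in M. T\<^sub>1 \<omega> > x \<and> T \<omega> > y) = D (Fbar x, Fbar y)) \<and>
    (\<forall>g. (\<forall>z. 0 \<le> g z) \<and> distributed M lborel (\<lambda>\<omega>. (T\<^sub>1 \<omega>, T \<omega>)) (\<lambda>z. ennreal (g z)) \<longrightarrow>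
      (AE t in distr M borel T\<^sub>1. \<forall>L.
        (\<forall>v\<in>{0<..1}. has_partial1 D (Fbar t) v) \<and>
        ((\<lambda>v. partial1 D (Fbar t) v) \<longlongrightarrow> L) (at_right 0) \<longrightarrow>
          marginal1_density g t \<noteq> 0 \<and> partial1 D (Fbar t) 1 \<noteq> 0 \<and>
          (\<forall>y\<ge>t. cond_reliability g t y
             = (partial1 D (Fbar t) (Fbar y) - L) / partial1 D (Fbar t) 1)))"
proof -
  interpret prob_space M by fact
  note X [measurable] = assms(2)
  let ?law = "\<lambda>i. distr M borel (\<lambda>\<omega>. X \<omega> $ i)"
  have law: "real_distribution (?law i)" for i
    by (intro real_distribution_distr) measurable
  \<comment> \<open>\<open>undefined\<close> is merely some component index; all component laws have
    the same distribution function and hence coincide.\<close>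
  define \<nu> where "\<nu> = ?law undefined"
  have tail: "measure (?law i) {x<..} = Fbar x" for i x
    using assms(5)[where i = i and x = x]
    by (subst measure_distr) (auto simp: vimage_def Int_def conj_commute)
  have "cdf (?law i) x = 1 - Fbar x" for i x
  proof -
    interpret L: real_distribution "?law i" by (rule law)
    show ?thesis
      using L.prob_compl[of "{..x}"] tail[of i x]
      by (simp add: cdf_def Compl_eq_Diff_UNIV[symmetric])
  qed
  then have law_eq: "?law i = \<nu>" for i
    unfolding \<nu>_def by (intro cdf_unique law) (simp add: fun_eq_iff)
  have \<nu>: "real_distribution \<nu>"
    unfolding \<nu>_def by (rule law)
  have "absolutely_continuous lborel \<nu>"
    unfolding \<nu>_def by (rule absolutely_continuous_component[OF X assms(4)])
  then obtain f where f: "integrable lborel f" "\<And>x. 0 \<le> f x" "\<nu> = density lborel (\<lambda>x. ennreal (f x))"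
    using real_density_exists[OF \<nu>] by metis
  have T_eq: "T\<^sub>1 = (\<lambda>\<omega>. system_lifetime \<phi>\<^sub>1 (X \<omega>))" "T = (\<lambda>\<omega>. system_lifetime \<phi> (X \<omega>))"
    using assms(8,9) by auto
  have "dominated_pair M \<nu> T\<^sub>1 T (real CARD('n)) f"
    unfolding T_eq
  proof (intro dominated_pair.intro dominated_pair_axioms.intro prob_space_axioms \<nu> f)
    show "(\<lambda>\<omega>. system_lifetime \<phi>\<^sub>1 (X \<omega>)) \<in> borel_measurable M"
      "(\<lambda>\<omega>. system_lifetime \<phi> (X \<omega>)) \<in> borel_measurable M"
      by measurable
  qed (intro measure_system_lifetime_le[OF prob_space_axioms X _ law_eq] assms(6,7); assumption)+
  then interpret P: dominated_pair M \<nu> T\<^sub>1 T "real CARD('n)" f .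
  have Fbar: "Fbar = P.tail"
    using tail[of undefined] by (simp add: fun_eq_iff P.tail_def \<nu>_def[symmetric])
  show ?thesis
    unfolding Fbar
  proof (intro exI conjI allI impI)
    show "bivariate_distortion P.distortion"
      by (rule P.bivariate_distortion)
    show "\<P>(\<omega> in M. T\<^sub>1 \<omega> > x \<and> T \<omega> > y) = P.distortion (P.tail x, P.tail y)" for x y
      by (rule P.joint_tail)
  next
    fix g :: "real \<times> real \<Rightarrow> real"
    assume "(\<forall>z. 0 \<le> g z) \<and> distributed M lborel (\<lambda>\<omega>. (T\<^sub>1 \<omega>, T \<omega>)) (\<lambda>z. ennreal (g z))"
    then have "AE t in distr M borel T\<^sub>1. \<forall>L.
        (\<forall>v\<in>{0<..1}. has_partial1 P.distortion (P.tail t) v) \<and>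
        ((\<lambda>v. partial1 P.distortion (P.tail t) v) \<longlongrightarrow> L) (at_right 0) \<longrightarrow>
          marginal1_density g t \<noteq> 0 \<and> partial1 P.distortion (P.tail t) 1 \<noteq> 0 \<and>
          (\<forall>y. cond_reliability g t y
             = (partial1 P.distortion (P.tail t) (P.tail y) - L) / partial1 P.distortion (P.tail t) 1)"
      by (intro P.conditional_reliability) auto
    then show "AE t in distr M borel T\<^sub>1. \<forall>L.
        (\<forall>v\<in>{0<..1}. has_partial1 P.distortion (P.tail t) v) \<and>
        ((\<lambda>v. partial1 P.distortion (P.tail t) v) \<longlongrightarrow> L) (at_right 0) \<longrightarrow>
          marginal1_density g t \<noteq> 0 \<and> partial1 P.distortion (P.tail t) 1 \<noteq> 0 \<and>
          (\<forall>y\<ge>t. cond_reliability g t y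
             = (partial1 P.distortion (P.tail t) (P.tail y) - L) / partial1 P.distortion (P.tail t) 1)"
      by eventually_elim blast
  qed
qed

end
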